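(* Let $F_S$ be a free group on a nonempty set $S$ and $A$ a finite set of size $q \geq 2$. Then the monoid $\mathrm{CA}(F_S;A)$ is not finitely generated.
   Context: For a group $G$ and a finite set $A$, $A^G$ is the set of all functions $x : G \to A$, with the shift action $(g\cdot x)(h) = x(g^{-1}h)$. A cellular automaton over $A^G$ is a map $\tau : A^G \to A^G$ for which there exist a finite subset $E \subseteq G$ and a function $\mu : A^E \to A$ such that $\tau(x)(g) = \mu((g^{-1}\cdot x)|_E)$ for all $x \in A^G$, $g\in G$. $\mathrm{CA}(G;A)$ is the monoid of all cellular automata over $A^G$ under composition. A monoid is finitely generated if it is generated, as a monoid, by a finite subset. *)

theory Defs
  imports "HOL-Algebra.Group" "HOL-Library.FuncSet"
begin

text \<open>The letter \<open>(s, True)\<close> stands for the generator \<open>s\<close> and \<open>(s, False)\<close> for its formal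
  inverse.  The free group on \<open>S\<close> is realised on the reduced words over \<open>S\<close>; the product is
  concatenation followed by free reduction.\<close>

type_synonym 's letter = "'s \<times> bool"

definition letter_inv :: "'s letter \<Rightarrow> 's letter" where
  "letter_inv l = (fst l, \<not> snd l)"

definition reduced :: "'s letter list \<Rightarrow> bool" where
  "reduced = successively (\<lambda>l m. m \<noteq> letter_inv l)"

fun push :: "'s letter \<Rightarrow> 's letter list \<Rightarrow> 's letter list" where
  "push l [] = [l]"
| "push l (m # w) = (if m = letter_inv l then w else l # m # w)"

text \<open>For reduced \<open>v\<close>, the word \<open>foldr push u v\<close> is the reduced form of \<open>u @ v\<close>.\<close>

definition free_group :: "'s set \<Rightarrow> 's letter list monoid" where
  "free_group S =
    \<lparr>carrier = {w. reduced w \<and> fst ` set w \<subseteq> S},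
     mult = (\<lambda>u v. foldr push u v),
     one = []\<rparr>"

lemma letter_inv_inv [simp]: "letter_inv (letter_inv l) = l"
  by (simp add: letter_inv_def)

lemma fst_letter_inv [simp]: "fst (letter_inv l) = fst l"
  by (simp add: letter_inv_def)

lemma reduced_Nil [simp]: "reduced []"
  by (simp add: reduced_def)

lemma reduced_Cons:
  "reduced (l # w) \<longleftrightarrow> reduced w \<and> (w = [] \<or> hd w \<noteq> letter_inv l)"
  by (cases w) (auto simp: reduced_def)

lemma reduced_push: "reduced w \<Longrightarrow> reduced (push l w)"
  by (cases w) (auto simp: reduced_Cons)

lemma push_reduced: "reduced (l # w) \<Longrightarrow> push l w = l # w"
  by (cases w) (auto simp: reduced_Cons)

lemma push_push_inv: "reduced w \<Longrightarrow> push l (push (letter_inv l) w) = w"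
  by (cases w) (auto simp: push_reduced)

lemma push_inv_push: "reduced w \<Longrightarrow> push (letter_inv l) (push l w) = w"
  using push_push_inv[of w "letter_inv l"] by simp

lemma set_push: "set (push l w) \<subseteq> insert l (set w)"
  by (cases w) auto

lemma reduced_foldr_push: "reduced v \<Longrightarrow> reduced (foldr push u v)"
  by (induction u) (auto intro: reduced_push)

lemma set_foldr_push: "set (foldr push u v) \<subseteq> set u \<union> set v"
proof (induction u)
  case (Cons l u)
  then show ?case using set_push[of l "foldr push u v"] by auto
qed simp

lemma foldr_push_Nil: "reduced u \<Longrightarrow> foldr push u [] = u"
proof (induction u)
  case (Cons l u)
  then show ?case using push_reduced[of l u] by (simp add: reduced_Cons)
qed simp

lemma foldr_push_push:
  assumes "reduced w"
  shows "foldr push (push l z) w = push l (foldr push z w)"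
proof (cases z)
  case (Cons m z')
  then show ?thesis
    using push_push_inv[OF reduced_foldr_push[OF assms], of l z'] by simp
qed simp

lemma foldr_push_assoc:
  "reduced w \<Longrightarrow> foldr push (foldr push u v) w = foldr push u (foldr push v w)"
  by (induction u) (simp_all add: foldr_push_push)

lemma foldr_push_inv:
  "reduced u \<Longrightarrow> foldr push (map letter_inv (rev u)) u = []"
proof (induction u)
  case (Cons l u)
  then have "reduced u" by (simp add: reduced_Cons)
  then have "push (letter_inv l) (l # u) = u" by simp
  then show ?case using Cons \<open>reduced u\<close> by simp
qed simp

lemma reduced_inv: "reduced u \<Longrightarrow> reduced (map letter_inv (rev u))"
  unfolding reduced_def
  by (simp add: successively_map successively_rev)
     (erule successively_mono, auto)

lemma group_free_group: "group (free_group S)"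
proof (rule groupI, goal_cases)
  case (1 x y)
  then show ?case
    using set_foldr_push[of x y] by (fastforce simp: free_group_def reduced_foldr_push)
next
  case (5 x)
  then show ?case
    by (intro bexI[of _ "map letter_inv (rev x)"])
       (auto simp: free_group_def foldr_push_inv reduced_inv)
qed (auto simp: free_group_def foldr_push_assoc)

lemma free_group_universal:
  fixes H (structure)
  assumes H: "group H" and f: "f \<in> S \<rightarrow> carrier H"
  shows "\<exists>!h. h \<in> hom (free_group S) H \<and> h \<in> extensional (carrier (free_group S))
           \<and> (\<forall>s\<in>S. h [(s, True)] = f s)"
proof -
  interpret H: group H by (rule H)
  interpret F: group "free_group S" by (rule group_free_group)
  let ?F = "carrier (free_group S)"
  define e where "e l = (if snd l then f (fst l) else inv (f (fst l)))" for l
  define ev where "ev w = foldr (\<lambda>l y. e l \<otimes> y) w \<one>" for w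
  have e: "e l \<in> carrier H" if "fst l \<in> S" for l
    using f that by (auto simp: e_def)
  have e_inv: "e (letter_inv l) = inv (e l)" if "fst l \<in> S" for l
    using funcset_mem[OF f that] by (simp add: e_def letter_inv_def)
  have ev: "ev w \<in> carrier H" if "fst ` set w \<subseteq> S" for w
    using that by (induction w) (auto simp: ev_def e)
  have ev_Cons: "ev (l # w) = e l \<otimes> ev w" for l w
    by (simp add: ev_def)
  have ev_push: "ev (push l w) = e l \<otimes> ev w" if "fst l \<in> S" "fst ` set w \<subseteq> S" for l w
    using that by (cases w) (auto simp: ev_Cons e e_inv ev H.m_assoc[symmetric])
  have ev_mult: "ev (foldr push u v) = ev u \<otimes> ev v"
    if "fst ` set u \<subseteq> S" "fst ` set v \<subseteq> S" for u v
    using that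
  proof (induction u)
    case Nil
    then show ?case using ev by (simp add: ev_def)
  next
    case (Cons l u)
    have "fst ` set (foldr push u v) \<subseteq> S"
      using Cons.prems set_foldr_push[of u v] by fastforce
    then show ?case
      using Cons by (simp add: ev_push ev_Cons H.m_assoc e ev)
  qed
  have F: "fst ` set w \<subseteq> S" if "w \<in> ?F" for w
    using that by (simp add: free_group_def)
  have gen: "[(s, b)] \<in> ?F" if "s \<in> S" for s b
    using that by (simp add: free_group_def reduced_def)
  let ?h = "restrict ev ?F"
  show ?thesis
  proof (rule ex1I[of _ ?h])
    have "?h \<in> hom (free_group S) H"
    proof (rule homI)
      fix x y assume xy: "x \<in> ?F" "y \<in> ?F"
      then have "x \<otimes>\<^bsub>free_group S\<^esub> y \<in> ?F" by simp
      with xy show "?h (x \<otimes>\<^bsub>free_group S\<^esub> y) = ?h x \<otimes> ?h y"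
        using ev_mult[OF F F] by (simp add: free_group_def)
    qed (use ev F in auto)
    moreover have "\<forall>s\<in>S. ?h [(s, True)] = f s"
      using f gen by (auto simp: ev_def e_def Pi_iff)
    ultimately show "?h \<in> hom (free_group S) H \<and> ?h \<in> extensional ?F \<and>
        (\<forall>s\<in>S. ?h [(s, True)] = f s)" by simp
  next
    fix h assume h: "h \<in> hom (free_group S) H \<and> h \<in> extensional ?F \<and> (\<forall>s\<in>S. h [(s, True)] = f s)"
    interpret h: group_hom "free_group S" H h
      using h by (unfold_locales) auto
    have letter: "h [l] = e l" if "fst l \<in> S" for l
    proof -
      obtain s b where l: "l = (s, b)" by (cases l)
      have s: "s \<in> S" using that l by simp
      have "inv\<^bsub>free_group S\<^esub> [(s, True)] = [(s, False)]"
        by (rule F.inv_equality)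
           (use gen s in \<open>auto simp: free_group_def letter_inv_def\<close>)
      then have "h [(s, False)] = inv (f s)"
        using h.hom_inv[OF gen[OF s, of True]] h s by simp
      then show ?thesis using h s l by (cases b) (auto simp: e_def)
    qed
    have "h w = ev w" if "w \<in> ?F" for w
      using that
    proof (induction w)
      case Nil
      then show ?case using h.hom_one by (simp add: free_group_def ev_def)
    next
      case (Cons l w)
      have w: "w \<in> ?F" and l: "fst l \<in> S" and r: "reduced (l # w)"
        using Cons.prems by (auto simp: free_group_def reduced_Cons)
      have l1: "[l] \<in> ?F" using gen[of "fst l" "snd l"] l by simp
      have "l # w = [l] \<otimes>\<^bsub>free_group S\<^esub> w"
        using push_reduced[OF r] by (simp add: free_group_def)
      then have "h (l # w) = h [l] \<otimes> h w" using h.hom_mult[OF l1 w] by simp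
      then show ?case using Cons.IH[OF w] letter[OF l] by (simp add: ev_Cons)
    qed
    then show "h = ?h" using h by (intro extensionalityI[of _ ?F]) auto
  qed
qed

definition configs :: "('g, 'm) monoid_scheme \<Rightarrow> 'a set \<Rightarrow> ('g \<Rightarrow> 'a) set" where
  "configs G A = carrier G \<rightarrow>\<^sub>E A"

definition shift :: "('g, 'm) monoid_scheme \<Rightarrow> 'g \<Rightarrow> ('g \<Rightarrow> 'a) \<Rightarrow> ('g \<Rightarrow> 'a)" where
  "shift G g x = (\<lambda>h\<in>carrier G. x (inv\<^bsub>G\<^esub> g \<otimes>\<^bsub>G\<^esub> h))"

definition cellular_automaton ::
  "('g, 'm) monoid_scheme \<Rightarrow> 'a set \<Rightarrow> (('g \<Rightarrow> 'a) \<Rightarrow> ('g \<Rightarrow> 'a)) \<Rightarrow> bool" where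
  "cellular_automaton G A \<tau> \<longleftrightarrow>
     \<tau> \<in> configs G A \<rightarrow>\<^sub>E configs G A \<and>
     (\<exists>E \<mu>. finite E \<and> E \<subseteq> carrier G \<and> \<mu> \<in> (E \<rightarrow>\<^sub>E A) \<rightarrow> A \<and>
        (\<forall>x\<in>configs G A. \<forall>g\<in>carrier G.
           \<tau> x g = \<mu> (restrict (shift G (inv\<^bsub>G\<^esub> g) x) E)))"

definition CA :: "('g, 'm) monoid_scheme \<Rightarrow> 'a set \<Rightarrow> (('g \<Rightarrow> 'a) \<Rightarrow> ('g \<Rightarrow> 'a)) monoid" where
  "CA G A =
    \<lparr>carrier = {\<tau>. cellular_automaton G A \<tau>},
     mult = compose (configs G A),
     one = (\<lambda>x\<in>configs G A. x)\<rparr>"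

lemma shift_in_configs:
  assumes "group G" "g \<in> carrier G" "x \<in> configs G A"
  shows "shift G g x \<in> configs G A"
proof -
  interpret group G by (rule assms)
  show ?thesis using assms(2,3) by (auto simp: configs_def shift_def)
qed

lemma cellular_automaton_id:
  assumes "group G"
  shows "cellular_automaton G A (\<lambda>x\<in>configs G A. x)"
proof -
  interpret group G by (rule assms)
  show ?thesis unfolding cellular_automaton_def
    by (intro conjI exI[of _ "{\<one>\<^bsub>G\<^esub>}"] exI[of _ "\<lambda>y. y \<one>\<^bsub>G\<^esub>"])
       (auto simp: shift_def)
qed

lemma cellular_automaton_compose:
  assumes "group G" and \<sigma>: "cellular_automaton G A \<sigma>" and \<tau>: "cellular_automaton G A \<tau>"
  shows "cellular_automaton G A (compose (configs G A) \<sigma> \<tau>)"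
proof -
  interpret group G by (rule assms)
  let ?C = "configs G A"
  obtain E \<mu> where E: "finite E" "E \<subseteq> carrier G" "\<mu> \<in> (E \<rightarrow>\<^sub>E A) \<rightarrow> A"
    and \<mu>: "\<And>x g. \<lbrakk>x \<in> ?C; g \<in> carrier G\<rbrakk> \<Longrightarrow> \<sigma> x g = \<mu> (restrict (shift G (inv\<^bsub>G\<^esub> g) x) E)"
    using \<sigma> unfolding cellular_automaton_def by metis
  obtain D \<nu> where D: "finite D" "D \<subseteq> carrier G" "\<nu> \<in> (D \<rightarrow>\<^sub>E A) \<rightarrow> A"
    and \<nu>: "\<And>x g. \<lbrakk>x \<in> ?C; g \<in> carrier G\<rbrakk> \<Longrightarrow> \<tau> x g = \<nu> (restrict (shift G (inv\<^bsub>G\<^esub> g) x) D)"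
    using \<tau> unfolding cellular_automaton_def by metis
  have \<sigma>C: "\<sigma> \<in> ?C \<rightarrow>\<^sub>E ?C" and \<tau>C: "\<tau> \<in> ?C \<rightarrow>\<^sub>E ?C"
    using \<sigma> \<tau> by (auto simp: cellular_automaton_def)
  define K where "K = (\<lambda>(e, d). e \<otimes>\<^bsub>G\<^esub> d) ` (E \<times> D)"
  define \<kappa> where "\<kappa> y = \<mu> (\<lambda>e\<in>E. \<nu> (\<lambda>d\<in>D. y (e \<otimes>\<^bsub>G\<^esub> d)))" for y
  have K: "finite K" "K \<subseteq> carrier G"
    using E D by (auto simp: K_def)
  have \<kappa>: "\<kappa> \<in> (K \<rightarrow>\<^sub>E A) \<rightarrow> A"
  proof
    fix y assume y: "y \<in> K \<rightarrow>\<^sub>E A"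
    have "(\<lambda>d\<in>D. y (e \<otimes>\<^bsub>G\<^esub> d)) \<in> D \<rightarrow>\<^sub>E A" if "e \<in> E" for e
      using y that by (auto simp: K_def)
    then have "(\<lambda>e\<in>E. \<nu> (\<lambda>d\<in>D. y (e \<otimes>\<^bsub>G\<^esub> d))) \<in> E \<rightarrow>\<^sub>E A"
      using funcset_mem[OF D(3)] by (simp add: restrict_PiE_iff)
    then show "\<kappa> y \<in> A" unfolding \<kappa>_def by (rule funcset_mem[OF E(3)])
  qed
  have "compose ?C \<sigma> \<tau> x g = \<kappa> (restrict (shift G (inv\<^bsub>G\<^esub> g) x) K)"
    if x: "x \<in> ?C" and g: "g \<in> carrier G" for x g
  proof -
    have \<tau>x: "\<tau> x \<in> ?C" using \<tau>C x by auto
    have "restrict (shift G (inv\<^bsub>G\<^esub> g) (\<tau> x)) E =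
        (\<lambda>e\<in>E. \<nu> (\<lambda>d\<in>D. restrict (shift G (inv\<^bsub>G\<^esub> g) x) K (e \<otimes>\<^bsub>G\<^esub> d)))"
    proof (rule restrict_ext)
      fix e assume e: "e \<in> E"
      then have eG: "e \<in> carrier G" using E by auto
      have "restrict (shift G (inv\<^bsub>G\<^esub> (g \<otimes>\<^bsub>G\<^esub> e)) x) D =
          (\<lambda>d\<in>D. restrict (shift G (inv\<^bsub>G\<^esub> g) x) K (e \<otimes>\<^bsub>G\<^esub> d))"
      proof (rule restrict_ext)
        fix d assume d: "d \<in> D"
        then have "d \<in> carrier G" "e \<otimes>\<^bsub>G\<^esub> d \<in> K" using D e by (auto simp: K_def)
        then show "shift G (inv\<^bsub>G\<^esub> (g \<otimes>\<^bsub>G\<^esub> e)) x d =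
            restrict (shift G (inv\<^bsub>G\<^esub> g) x) K (e \<otimes>\<^bsub>G\<^esub> d)"
          using g eG by (simp add: shift_def m_assoc)
      qed
      then show "shift G (inv\<^bsub>G\<^esub> g) (\<tau> x) e =
          \<nu> (\<lambda>d\<in>D. restrict (shift G (inv\<^bsub>G\<^esub> g) x) K (e \<otimes>\<^bsub>G\<^esub> d))"
        using \<nu>[OF x, of "g \<otimes>\<^bsub>G\<^esub> e"] g eG by (simp add: shift_def)
    qed
    then show ?thesis
      using \<mu>[OF \<tau>x g] x by (simp add: compose_eq \<kappa>_def)
  qed
  moreover have "compose ?C \<sigma> \<tau> \<in> ?C \<rightarrow>\<^sub>E ?C"
    using \<sigma>C \<tau>C by (auto simp: compose_def)
  ultimately show ?thesis
    unfolding cellular_automaton_def using K \<kappa> by blast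
qed

lemma monoid_CA:
  assumes "group G"
  shows "monoid (CA G A)"
proof (rule monoidI, goal_cases)
  case (3 x y z)
  then have "z \<in> configs G A \<rightarrow> configs G A"
    by (auto simp: CA_def cellular_automaton_def)
  then show ?case using compose_assoc[of z "configs G A" "configs G A" x y] by (simp add: CA_def)
next
  case (4 x)
  then have "x \<in> configs G A \<rightarrow>\<^sub>E configs G A"
    by (auto simp: CA_def cellular_automaton_def)
  then show ?case using Id_compose[of x "configs G A" "configs G A"]
    by (auto simp: CA_def PiE_def)
next
  case (5 x)
  then have "x \<in> configs G A \<rightarrow>\<^sub>E configs G A"
    by (auto simp: CA_def cellular_automaton_def)
  then show ?case using compose_Id[of x "configs G A" "configs G A"]
    by (auto simp: CA_def PiE_def)
qed (use assms in \<open>auto simp: CA_def cellular_automaton_id cellular_automaton_compose\<close>)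

definition monoid_generated :: "('a, 'm) monoid_scheme \<Rightarrow> 'a set \<Rightarrow> 'a set" where
  "monoid_generated M X = \<Inter> {N. submonoid N M \<and> X \<subseteq> N}"

definition finitely_generated_monoid :: "('a, 'm) monoid_scheme \<Rightarrow> bool" where
  "finitely_generated_monoid M \<longleftrightarrow>
     (\<exists>X. finite X \<and> X \<subseteq> carrier M \<and> monoid_generated M X = carrier M)"

end

theory Submission
  imports Defs "HOL-Algebra.Elementary_Groups"
begin

text \<open>A free group surjects onto the integers, so it has configurations of every period \<open>n\<close>; they
  form a finite set \<open>P n\<close> mapped into itself by every cellular automaton.  If a product of automata
  is injective on the finite set \<open>P n\<close>, then so is every factor.  As \<open>P (2 ^ i)\<close> increases with
  \<open>i\<close>, for all large \<open>i\<close> each of finitely many given automata that is injective on \<open>P (2 ^ i)\<close> is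
  injective on \<open>P (2 ^ (i + 1))\<close>, and hence so is each automaton that they generate.  But replacing
  by \<open>b\<close> each symbol \<open>a \<noteq> b\<close> that is followed by \<open>2 n - 1\<close> symbols \<open>b\<close> is the identity on \<open>P n\<close>
  and not injective on \<open>P (2 n)\<close>.\<close>

section \<open>Periodic configurations along a homomorphism to the integers\<close>

text \<open>For a homomorphism \<open>\<phi>\<close> these are the configurations fixed by the
  shifts by all elements of the normal subgroup where \<open>n\<close> divides
  \<open>\<phi>\<close>; congruences between values of \<open>\<phi>\<close> replace its
  cosets.\<close>

definition periodic_configs ::
  "('g, 'm) monoid_scheme \<Rightarrow> 'a set \<Rightarrow> ('g \<Rightarrow> int) \<Rightarrow> int \<Rightarrow> ('g \<Rightarrow> 'a) set" where
  "periodic_configs G A \<phi> n =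
    {x \<in> configs G A. \<forall>g\<in>carrier G. \<forall>h\<in>carrier G. n dvd \<phi> g - \<phi> h \<longrightarrow> x g = x h}"

lemma periodic_configsI:
  assumes "x \<in> configs G A"
    and "\<And>g h. \<lbrakk>g \<in> carrier G; h \<in> carrier G; n dvd \<phi> g - \<phi> h\<rbrakk> \<Longrightarrow> x g = x h"
  shows "x \<in> periodic_configs G A \<phi> n"
  using assms unfolding periodic_configs_def by blast

lemma periodic_configsD:
  assumes "x \<in> periodic_configs G A \<phi> n"
  shows "x \<in> configs G A"
    and "\<lbrakk>g \<in> carrier G; h \<in> carrier G; n dvd \<phi> g - \<phi> h\<rbrakk> \<Longrightarrow> x g = x h"
  using assms unfolding periodic_configs_def by blast+

lemma periodic_configs_mono:
  "m dvd n \<Longrightarrow> periodic_configs G A \<phi> m \<subseteq> periodic_configs G A \<phi> n"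
  unfolding periodic_configs_def using dvd_trans by blast

text \<open>One symbol for each residue modulo \<open>n\<close> determines such a
  configuration.\<close>

lemma finite_periodic_configs:
  assumes "finite A" and surj: "\<phi> ` carrier G = UNIV" and n: "n > 0"
  shows "finite (periodic_configs G A \<phi> n)"
proof -
  let ?u = "inv_into (carrier G) \<phi>"
  have u: "?u k \<in> carrier G" "\<phi> (?u k) = k" for k
    using surj by (simp_all add: inv_into_into f_inv_into_f)
  have "x \<in> (\<lambda>y. \<lambda>g\<in>carrier G. y (\<phi> g mod n)) ` ({0..<n} \<rightarrow>\<^sub>E A)"
    if x: "x \<in> periodic_configs G A \<phi> n" for x
  proof (rule image_eqI)
    \<comment> \<open>The witness reads \<open>x\<close> at one chosen preimage of each
      residue.\<close>
    show "(\<lambda>k\<in>{0..<n}. x (?u k)) \<in> {0..<n} \<rightarrow>\<^sub>E A"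
      using periodic_configsD(1)[OF x] u by (auto simp: configs_def)
    have "x g = x (?u (\<phi> g mod n))" if "g \<in> carrier G" for g
      using that u by (intro periodic_configsD(2)[OF x]) simp_all
    then show "x = (\<lambda>g\<in>carrier G. (\<lambda>k\<in>{0..<n}. x (?u k)) (\<phi> g mod n))"
      using periodic_configsD(1)[OF x] n
      by (intro extensionalityI[of _ "carrier G"]) (auto simp: configs_def PiE_def)
  qed
  then show ?thesis
    using finite_subset[OF subsetI] \<open>finite A\<close> by (metis finite_PiE finite_atLeastLessThan_int finite_imageI)
qed

text \<open>The local rule at \<open>g\<close> reads \<open>x\<close> at the products of
  \<open>g\<close> with elements \<open>e\<close> of \<open>E\<close>, where \<open>\<phi>\<close>
  takes the value \<open>\<phi> g + \<phi> e\<close>. Hence places with congruent values of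
  \<open>\<phi>\<close> see the same pattern.\<close>

lemma cellular_automaton_periodic_configs:
  assumes "group G" and \<phi>: "\<phi> \<in> hom G integer_group"
    and \<tau>: "cellular_automaton G A \<tau>" and x: "x \<in> periodic_configs G A \<phi> n"
  shows "\<tau> x \<in> periodic_configs G A \<phi> n"
proof -
  interpret group G by (rule assms)
  have xC: "x \<in> configs G A"
    using x by (rule periodic_configsD)
  obtain E \<mu> where E: "E \<subseteq> carrier G" and \<mu>: "\<And>g. g \<in> carrier G \<Longrightarrow>
      \<tau> x g = \<mu> (restrict (shift G (inv\<^bsub>G\<^esub> g) x) E)"
    using \<tau> xC unfolding cellular_automaton_def by metis
  have "\<tau> x g = \<tau> x h"
    if gh: "g \<in> carrier G" "h \<in> carrier G" and d: "n dvd \<phi> g - \<phi> h" for g h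
  proof -
    have "x (g \<otimes>\<^bsub>G\<^esub> e) = x (h \<otimes>\<^bsub>G\<^esub> e)" if "e \<in> carrier G" for e
      using gh d that hom_mult[OF \<phi>] by (intro periodic_configsD(2)[OF x]) simp_all
    then have "restrict (shift G (inv\<^bsub>G\<^esub> g) x) E = restrict (shift G (inv\<^bsub>G\<^esub> h) x) E"
      using E gh by (intro restrict_ext) (auto simp: shift_def)
    then show ?thesis
      using \<mu> gh by simp
  qed
  moreover have "\<tau> x \<in> configs G A"
    using \<tau> xC by (auto simp: cellular_automaton_def)
  ultimately show ?thesis
    by (rule periodic_configsI[rotated])
qed

section \<open>An automaton that loses injectivity when the period doubles\<close>

lemma cellular_automaton_erase_isolated:
  fixes A :: "'b set"
  assumes "group G" and b: "b \<in> A" and D: "finite D" "D \<subseteq> carrier G"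
  shows "cellular_automaton G A (\<lambda>x\<in>configs G A. \<lambda>g\<in>carrier G.
    if x g = a \<and> (\<forall>d\<in>D. x (g \<otimes>\<^bsub>G\<^esub> d) = b) then b else x g)"
proof -
  interpret group G by (rule assms)
  let ?E = "insert \<one>\<^bsub>G\<^esub> D"
  let ?\<mu> = "\<lambda>y. if y \<one>\<^bsub>G\<^esub> = a \<and> (\<forall>d\<in>D. y d = b) then b else y \<one>\<^bsub>G\<^esub>"
  have 1: "?\<mu> \<in> (?E \<rightarrow>\<^sub>E A) \<rightarrow> A"
    using b by auto
  have 2: "shift G (inv\<^bsub>G\<^esub> g) x e = x (g \<otimes>\<^bsub>G\<^esub> e)"
    if "g \<in> carrier G" "e \<in> carrier G" for g e and x :: "'a \<Rightarrow> 'b"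
    using that by (simp add: shift_def)
  show ?thesis
    unfolding cellular_automaton_def
  proof (intro conjI exI[of _ ?E] exI[of _ ?\<mu>] 1 ballI)
    show "(\<lambda>x\<in>configs G A. \<lambda>g\<in>carrier G.
        if x g = a \<and> (\<forall>d\<in>D. x (g \<otimes>\<^bsub>G\<^esub> d) = b) then b else x g)
        \<in> configs G A \<rightarrow>\<^sub>E configs G A"
      using b by (auto simp: configs_def)
  next
    fix x g assume x: "x \<in> configs G A" and g: "g \<in> carrier G"
    have "(\<forall>d\<in>D. shift G (inv\<^bsub>G\<^esub> g) x d = b) \<longleftrightarrow> (\<forall>d\<in>D. x (g \<otimes>\<^bsub>G\<^esub> d) = b)"
      using D g 2 by (metis subsetD)
    then show "(\<lambda>x\<in>configs G A. \<lambda>g\<in>carrier G.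
        if x g = a \<and> (\<forall>d\<in>D. x (g \<otimes>\<^bsub>G\<^esub> d) = b) then b else x g) x g =
        ?\<mu> (restrict (shift G (inv\<^bsub>G\<^esub> g) x) ?E)"
      using x g 2[OF g one_closed] by simp
  qed (use D in auto)
qed

text \<open>In period \<open>n\<close> every symbol recurs at offset \<open>n\<close>, so no
  \<open>a\<close> is followed by \<open>2 * n - 1\<close> symbols \<open>b\<close> and the rule
  never acts. In period \<open>2 * n\<close> a single \<open>a\<close> per period is erased, which
  yields the constant configuration \<open>b\<close>, itself a fixed point.\<close>

lemma ex_automaton_collapsing_doubled_period:
  assumes "group G" and \<phi>: "\<phi> \<in> hom G integer_group" and surj: "\<phi> ` carrier G = UNIV"
    and ab: "a \<in> A" "b \<in> A" "a \<noteq> b" and n: "n > 0"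
  obtains \<tau> where "cellular_automaton G A \<tau>" "inj_on \<tau> (periodic_configs G A \<phi> n)"
    "\<not> inj_on \<tau> (periodic_configs G A \<phi> (2 * n))"
proof -
  interpret group G by (rule assms)
  let ?u = "inv_into (carrier G) \<phi>"
  have u: "?u k \<in> carrier G" "\<phi> (?u k) = k" for k
    using surj by (simp_all add: inv_into_into f_inv_into_f)
  have \<phi>_mult: "\<phi> (g \<otimes>\<^bsub>G\<^esub> h) = \<phi> g + \<phi> h" if "g \<in> carrier G" "h \<in> carrier G" for g h
    using hom_mult[OF \<phi> that] by simp
  \<comment> \<open>One group element for each offset strictly between 0 and
    \<open>2 * n\<close>.\<close>
  define D where "D = ?u ` {1..<2 * n}"
  define \<tau> where "\<tau> = (\<lambda>x\<in>configs G A. \<lambda>g\<in>carrier G.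
    if x g = a \<and> (\<forall>d\<in>D. x (g \<otimes>\<^bsub>G\<^esub> d) = b) then b else x g)"
  have D: "finite D" "D \<subseteq> carrier G"
    using u by (auto simp: D_def)
  have \<tau>_id: "\<tau> x = x" if x: "x \<in> periodic_configs G A \<phi> n" for x
  proof -
    have xC: "x \<in> configs G A"
      using x by (rule periodic_configsD)
    \<comment> \<open>At offset \<open>n\<close> the symbol \<open>x g\<close> appears again, so the
      condition for replacing it would force \<open>a = b\<close>.\<close>
    have "?u n \<in> D"
      using n by (simp add: D_def)
    moreover have "x (g \<otimes>\<^bsub>G\<^esub> ?u n) = x g" if "g \<in> carrier G" for g
      using u that by (intro periodic_configsD(2)[OF x]) (simp_all add: \<phi>_mult)
    ultimately have "\<tau> x g = x g" if "g \<in> carrier G" for g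
      using xC that ab by (simp add: \<tau>_def) metis
    then show ?thesis
      using xC by (intro extensionalityI[of _ "carrier G"])
        (auto simp: \<tau>_def configs_def PiE_def)
  qed
  define x where "x = (\<lambda>g\<in>carrier G. if 2 * n dvd \<phi> g then a else b)"
  define y where "y = (\<lambda>g\<in>carrier G. b)"
  have x: "x \<in> periodic_configs G A \<phi> (2 * n)"
  proof (rule periodic_configsI)
    fix g h assume gh: "g \<in> carrier G" "h \<in> carrier G" "2 * n dvd \<phi> g - \<phi> h"
    then have "2 * n dvd \<phi> g \<longleftrightarrow> 2 * n dvd \<phi> h"
      using dvd_add_right_iff[of "2 * n" "\<phi> g - \<phi> h" "\<phi> h"] by simp
    then show "x g = x h"
      using gh by (simp add: x_def)
  qed (use ab in \<open>auto simp: x_def configs_def\<close>)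
  have y: "y \<in> periodic_configs G A \<phi> (2 * n)"
    using ab by (intro periodic_configsI) (auto simp: y_def configs_def)
  note xC = periodic_configsD(1)[OF x] and yC = periodic_configsD(1)[OF y]
  have "x (?u 0) \<noteq> y (?u 0)"
    using u ab by (simp add: x_def y_def)
  then have "x \<noteq> y"
    by auto
  moreover have "\<tau> x = \<tau> y"
  proof -
    \<comment> \<open>The offsets stop short of the next multiple of \<open>2 * n\<close>, so every
      \<open>a\<close> in \<open>x\<close> is isolated and gets erased.\<close>
    have "x (g \<otimes>\<^bsub>G\<^esub> d) = b" if g: "g \<in> carrier G" "2 * n dvd \<phi> g" and "d \<in> D" for g d
    proof -
      obtain k where k: "d = ?u k" "0 < k" "k < 2 * n"
        using \<open>d \<in> D\<close> by (auto simp: D_def)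
      then have "\<not> 2 * n dvd \<phi> g + k"
        using g zdvd_not_zless dvd_add_right_iff by metis
      then show ?thesis
        using k g u by (simp add: x_def \<phi>_mult)
    qed
    then have "\<tau> x g = \<tau> y g" if "g \<in> carrier G" for g
      using xC yC that D by (auto simp: \<tau>_def) (auto simp: x_def y_def)
    then show ?thesis
      using xC yC by (intro extensionalityI[of _ "carrier G"]) (auto simp: \<tau>_def)
  qed
  ultimately have "\<not> inj_on \<tau> (periodic_configs G A \<phi> (2 * n))"
    using x y by (meson inj_onD)
  moreover have "inj_on \<tau> (periodic_configs G A \<phi> n)"
    using \<tau>_id by (metis inj_onI)
  moreover have "cellular_automaton G A \<tau>"
    unfolding \<tau>_def using assms(1) ab(2) D by (intro cellular_automaton_erase_isolated)
  ultimately show ?thesis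
    using that by blast
qed

section \<open>The obstruction to finite generation\<close>

text \<open>The point is closure under products. If the product of \<sigma> and \<tau> is injective
  on the periodic configurations of period \<open>m\<close>, so is \<tau>; as an injective self-map
  of a finite set it is onto, so \<sigma> is injective there too. Both then stay injective for
  \<open>n\<close>, and so does their product.\<close>

lemma submonoid_CA_inj_extends:
  assumes "group G" and \<phi>: "\<phi> \<in> hom G integer_group"
    and fin: "finite (periodic_configs G A \<phi> m)"
  shows "submonoid {\<tau>. cellular_automaton G A \<tau> \<and> (inj_on \<tau> (periodic_configs G A \<phi> m) \<longrightarrow>
    inj_on \<tau> (periodic_configs G A \<phi> n))} (CA G A)"
    (is "submonoid ?N _")
proof
  let ?P = "periodic_configs G A \<phi>"
  let ?C = "configs G A"
  have PC: "?P k \<subseteq> ?C" for k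
    by (meson periodic_configsD(1) subsetI)
  show "?N \<subseteq> carrier (CA G A)"
    by (auto simp: CA_def)
  have "inj_on (\<lambda>x\<in>?C. x) (?P n)"
    using PC by (auto simp: inj_on_def)
  then show "\<one>\<^bsub>CA G A\<^esub> \<in> ?N"
    using cellular_automaton_id[OF assms(1)] by (simp add: CA_def)
  show "\<sigma> \<otimes>\<^bsub>CA G A\<^esub> \<tau> \<in> ?N" if "\<sigma> \<in> ?N" "\<tau> \<in> ?N" for \<sigma> \<tau>
  proof -
    have ca: "cellular_automaton G A \<sigma>" "cellular_automaton G A \<tau>"
      using that by auto
    have inv: "\<tau> ` ?P k \<subseteq> ?P k" for k
      using cellular_automaton_periodic_configs[OF assms(1) \<phi> ca(2)] by auto
    have comp: "inj_on (compose ?C \<sigma> \<tau>) (?P k) \<longleftrightarrow> inj_on (\<sigma> \<circ> \<tau>) (?P k)" for k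
      using subsetD[OF PC] by (intro inj_on_cong) (simp add: compose_eq)
    have "inj_on (compose ?C \<sigma> \<tau>) (?P n)" if inj: "inj_on (compose ?C \<sigma> \<tau>) (?P m)"
    proof -
      have \<tau>: "inj_on \<tau> (?P m)"
        using inj comp inj_on_imageI2 by blast
      then have "\<tau> ` ?P m = ?P m"
        using endo_inj_surj[OF fin inv] by blast
      then have "inj_on \<sigma> (?P m)"
        using inj comp inj_on_imageI by metis
      then have "inj_on \<sigma> (?P n)" "inj_on \<tau> (?P n)"
        using \<open>\<sigma> \<in> ?N\<close> \<open>\<tau> \<in> ?N\<close> \<tau> by auto
      then show ?thesis
        using comp inv comp_inj_on inj_on_subset by metis
    qed
    then show ?thesis
      using cellular_automaton_compose[OF assms(1) ca] by (simp add: CA_def)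
  qed
qed

text \<open>Finitely many generators admit a common \<open>i\<close> at which none of them loses
  injectivity on passing from period \<open>2 ^ i\<close> to its double. This property defines a
  submonoid, which would have to be everything.\<close>

theorem CA_not_finitely_generated:
  assumes "group G" and \<phi>: "\<phi> \<in> hom G integer_group" and surj: "\<phi> ` carrier G = UNIV"
    and A: "finite A" "card A \<ge> 2"
  shows "\<not> finitely_generated_monoid (CA G A)"
proof
  assume "finitely_generated_monoid (CA G A)"
  then obtain X where X: "finite X" "X \<subseteq> carrier (CA G A)"
    and gen: "monoid_generated (CA G A) X = carrier (CA G A)"
    by (auto simp: finitely_generated_monoid_def)
  obtain a b where ab: "a \<in> A" "b \<in> A" "a \<noteq> b"
    using A card_le_Suc0_iff_eq[of A] by fastforce
  define P where "P = periodic_configs G A \<phi>"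
  \<comment> \<open>The sets \<open>P (2 ^ i)\<close> increase with \<open>i\<close>, so injectivity
    once lost never returns, and the implication fails for at most one \<open>i\<close>.\<close>
  have "\<forall>\<^sub>F i in sequentially. inj_on \<sigma> (P (2 ^ i)) \<longrightarrow> inj_on \<sigma> (P (2 * 2 ^ i))"
    for \<sigma> :: "('a \<Rightarrow> 'c) \<Rightarrow> ('a \<Rightarrow> 'c)"
  proof (cases "\<forall>i. inj_on \<sigma> (P (2 ^ i))")
    case True
    then show ?thesis
      by (simp flip: power_Suc)
  next
    case False
    then obtain i where "\<not> inj_on \<sigma> (P (2 ^ i))"
      by blast
    then have "\<not> inj_on \<sigma> (P (2 ^ j))" if "j \<ge> i" for j
      using that inj_on_subset[OF _ periodic_configs_mono[OF le_imp_power_dvd[OF that]]]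
      unfolding P_def by blast
    then show ?thesis
      by (intro eventually_sequentiallyI[of i]) blast
  qed
  then have "\<forall>\<^sub>F i in sequentially. \<forall>\<sigma>\<in>X. inj_on \<sigma> (P (2 ^ i)) \<longrightarrow> inj_on \<sigma> (P (2 * 2 ^ i))"
    using X(1) by (simp add: eventually_ball_finite)
  then obtain i where i: "\<And>\<sigma>. \<lbrakk>\<sigma> \<in> X; inj_on \<sigma> (P (2 ^ i))\<rbrakk> \<Longrightarrow> inj_on \<sigma> (P (2 * 2 ^ i))"
    by (auto simp: eventually_sequentially)
  define N where "N = {\<tau>. cellular_automaton G A \<tau> \<and>
    (inj_on \<tau> (P (2 ^ i)) \<longrightarrow> inj_on \<tau> (P (2 * 2 ^ i)))}"
  have "submonoid N (CA G A)"
    unfolding N_def P_def using A assms(1-3)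
    by (intro submonoid_CA_inj_extends finite_periodic_configs) auto
  moreover have "X \<subseteq> N"
    using X(2) i by (auto simp: N_def CA_def)
  ultimately have "carrier (CA G A) \<subseteq> N"
    using gen unfolding monoid_generated_def by blast
  \<comment> \<open>The collapsing automaton for this very \<open>i\<close> lies outside
    \<open>N\<close>.\<close>
  moreover obtain \<tau> where "cellular_automaton G A \<tau>" "inj_on \<tau> (P (2 ^ i))"
      "\<not> inj_on \<tau> (P (2 * 2 ^ i))"
    using ex_automaton_collapsing_doubled_period[OF assms(1-3) ab, of "2 ^ i"]
    unfolding P_def by auto
  ultimately show False
    by (auto simp: N_def CA_def)
qed

section \<open>Free groups\<close>

text \<open>The universal property sends every generator to 1, so the integer powers of any one
  generator reach all integers.\<close>

lemma ex_epi_free_group_integer_group: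
  assumes "S \<noteq> {}"
  obtains \<phi> where "\<phi> \<in> hom (free_group S) integer_group" "\<phi> ` carrier (free_group S) = UNIV"
proof -
  interpret F: group "free_group S" by (rule group_free_group)
  obtain s where s: "s \<in> S"
    using assms by blast
  obtain \<phi> where \<phi>: "\<phi> \<in> hom (free_group S) integer_group" "\<forall>s\<in>S. \<phi> [(s, True)] = 1"
    using free_group_universal[OF group_integer_group, of "\<lambda>_. 1" S] by auto
  interpret \<phi>: group_hom "free_group S" integer_group \<phi>
    using \<phi>(1) by (intro group_hom.intro group_hom_axioms.intro group_free_group group_integer_group)
  let ?t = "[(s, True)]"
  have t: "?t \<in> carrier (free_group S)"
    using s by (simp add: free_group_def reduced_def)
  have "\<phi> (?t [^]\<^bsub>free_group S\<^esub> k) = k" for k :: int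
    using \<phi>.hom_int_pow[OF t, of k] \<phi>(2) s by simp
  then have "\<phi> ` carrier (free_group S) = UNIV"
    using t F.int_pow_closed by (metis image_eqI UNIV_eq_I)
  then show ?thesis
    using that \<phi>(1) by blast
qed

theorem corollary3:
  fixes S :: "'s set" and A :: "'a set" and q :: nat
  assumes "S \<noteq> {}" and "finite A" and "card A = q" and "q \<ge> 2"
  shows "\<not> finitely_generated_monoid (CA (free_group S) A)"
proof -
  obtain \<phi> where "\<phi> \<in> hom (free_group S) integer_group" "\<phi> ` carrier (free_group S) = UNIV"
    using ex_epi_free_group_integer_group[OF assms(1)] .
  then show ?thesis
    using CA_not_finitely_generated[OF group_free_group] assms by blast
qed

end
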